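(* Let $n\ge 2$ and let $\mathcal{C}(I,n)$ be the class of all vectors $\mathbf{X}=(X_1,\ldots,X_n)$ of independent $[0,1]$-valued random variables, with $U(\mathbf{X})=\max_i EX_i$ and $M(\mathbf{X})=E(\max_i X_i)$. Then for all $\mathbf{X}\in\mathcal{C}(I,n)$ with $U(\mathbf{X})>0$, $$M(\mathbf{X})/U(\mathbf{X})\le n,$$ and for all $\mathbf{X}\in\mathcal{C}(I,n)$, $$M(\mathbf{X})-U(\mathbf{X})\le n^{-1/(n-1)}-n^{-n/(n-1)}.$$ Moreover, equality in the latter inequality is attained by $\mathbf{Z}=(Z_1,\ldots,Z_n)$ with $Z_i$ iid Bernoulli random variables satisfying $P(Z_i=1)=1-n^{-1/(n-1)}$ (so that $U(\mathbf{Z})=1-n^{-1/(n-1)}$). *)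

theory Defs
  imports "HOL-Probability.Probability"
begin

text \<open>The class C(I,n): vectors (X_0,...,X_{n-1}) of independent [0,1]-valued
  random variables on a probability space M (indices shifted to 0..n-1).\<close>
definition class_CI :: "'a measure \<Rightarrow> nat \<Rightarrow> (nat \<Rightarrow> 'a \<Rightarrow> real) \<Rightarrow> bool" where
  "class_CI M n X \<longleftrightarrow> prob_space M
     \<and> (\<forall>i<n. X i \<in> borel_measurable M)
     \<and> prob_space.indep_vars M (\<lambda>_. borel) X {..<n}
     \<and> (\<forall>i<n. \<forall>\<omega>\<in>space M. X i \<omega> \<in> {0..1})"

definition U_max_exp :: "'a measure \<Rightarrow> nat \<Rightarrow> (nat \<Rightarrow> 'a \<Rightarrow> real) \<Rightarrow> real" where
  "U_max_exp M n X = (MAX i\<in>{..<n}. prob_space.expectation M (X i))"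

definition M_exp_max :: "'a measure \<Rightarrow> nat \<Rightarrow> (nat \<Rightarrow> 'a \<Rightarrow> real) \<Rightarrow> real" where
  "M_exp_max M n X = prob_space.expectation M (\<lambda>\<omega>. MAX i\<in>{..<n}. X i \<omega>)"

end

theory Submission
  imports Defs
begin

text \<open>For independent \<open>X\<^sub>i\<close> with values in \<open>[0,1]\<close>, pointwise
  \<open>max\<^sub>i X\<^sub>i \<le> \<Sum>\<^sub>i X\<^sub>i\<close> and \<open>max\<^sub>i X\<^sub>i \<le> 1 - \<Prod>\<^sub>i (1 - X\<^sub>i)\<close>, with equality
  in the latter for \<open>{0,1}\<close>-valued variables. Taking expectations, and using
  independence for the product, gives \<open>M \<le> n U\<close> and \<open>M \<le> 1 - \<Prod>\<^sub>i (1 - E X\<^sub>i) \<le> 1 - (1 - U)\<^sup>n\<close>.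
  Finally \<open>1 - (1 - U)\<^sup>n - U \<le> q - q\<^sup>n\<close> for \<open>q = n\<^sup>-\<^sup>1\<^sup>/\<^sup>(\<^sup>n\<^sup>-\<^sup>1\<^sup>)\<close>, because \<open>t \<mapsto> t\<^sup>n\<close>
  is convex and its tangent at \<open>q\<close> has slope \<open>n q\<^sup>n\<^sup>-\<^sup>1 = 1\<close>; the iid Bernoulli
  vector with mean \<open>1 - q\<close> attains it.\<close>

lemma Max_le_sum:
  fixes f :: "'i \<Rightarrow> 'b::{ordered_comm_monoid_add, linorder}"
  assumes "finite I" "I \<noteq> {}" "\<And>i. i \<in> I \<Longrightarrow> 0 \<le> f i"
  shows "(MAX i\<in>I. f i) \<le> (\<Sum>i\<in>I. f i)"
proof -
  have "f j \<le> (\<Sum>i\<in>I. f i)" if "j \<in> I" for j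
    using assms(1,3) refl that by (rule sum_nonneg_leq_bound)
  then show ?thesis using assms(1,2) by (subst Max_le_iff) auto
qed

lemma Max_le_one_minus_prod_complement:
  fixes f :: "'i \<Rightarrow> real"
  assumes "finite I" "I \<noteq> {}" "\<And>i. i \<in> I \<Longrightarrow> f i \<in> {0..1}"
  shows "(MAX i\<in>I. f i) \<le> 1 - (\<Prod>i\<in>I. 1 - f i)"
proof -
  have "f j \<le> 1 - (\<Prod>i\<in>I. 1 - f i)" if "j \<in> I" for j
  proof -
    have "(\<Prod>i\<in>I. 1 - f i) = (1 - f j) * (\<Prod>i\<in>I - {j}. 1 - f i)"
      using assms(1) that by (rule prod.remove)
    also have "\<dots> \<le> (1 - f j) * 1"
      using assms(3) that by (intro mult_left_mono prod_le_1) auto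
    finally show ?thesis by simp
  qed
  then show ?thesis using assms(1,2) by (subst Max_le_iff) auto
qed

lemma Max_eq_one_minus_prod_complement:
  fixes f :: "'i \<Rightarrow> real"
  assumes "finite I" "I \<noteq> {}" "\<And>i. i \<in> I \<Longrightarrow> f i \<in> {0, 1}"
  shows "(MAX i\<in>I. f i) = 1 - (\<Prod>i\<in>I. 1 - f i)"
proof (rule antisym)
  show "(MAX i\<in>I. f i) \<le> 1 - (\<Prod>i\<in>I. 1 - f i)"
  proof (rule Max_le_one_minus_prod_complement [OF assms(1,2)])
    fix i assume "i \<in> I"
    then show "f i \<in> {0..1}" using assms(3) by fastforce
  qed
  show "1 - (\<Prod>i\<in>I. 1 - f i) \<le> (MAX i\<in>I. f i)"
  proof (cases "\<exists>j\<in>I. f j = 1")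
    case True
    then obtain j where j: "j \<in> I" "f j = 1" by blast
    then have "(\<Prod>i\<in>I. 1 - f i) = 0" using assms(1) by (intro prod_zero) auto
    moreover have "f j \<le> (MAX i\<in>I. f i)" using assms(1) j by (intro Max_ge) auto
    ultimately show ?thesis using j by simp
  next
    case False
    then have zero: "\<And>i. i \<in> I \<Longrightarrow> f i = 0" using assms(3) by blast
    then have "(\<Prod>i\<in>I. 1 - f i) = 1" by (intro prod.neutral) simp
    moreover obtain j where j: "j \<in> I" using assms(2) by blast
    moreover have "f j \<le> (MAX i\<in>I. f i)" using assms(1) j by (intro Max_ge) auto
    ultimately show ?thesis using zero by simp
  qed
qed

lemma power_ge_tangent:
  fixes t q :: real
  assumes "0 \<le> t" "0 \<le> q"
  shows "q ^ n + real n * q ^ (n - 1) * (t - q) \<le> t ^ n"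
proof -
  have "(t - q) * (real n * q ^ (n - 1)) \<le> (t - q) * (\<Sum>i<n. q ^ (n - Suc i) * t ^ i)"
  proof (cases "q \<le> t")
    case True
    have "q ^ (n - 1) \<le> q ^ (n - Suc i) * t ^ i" if "i < n" for i
    proof -
      have "q ^ (n - 1) = q ^ (n - Suc i) * q ^ i"
        using that by (simp add: power_add [symmetric])
      also have "\<dots> \<le> q ^ (n - Suc i) * t ^ i"
        using True assms by (intro mult_left_mono power_mono) auto
      finally show ?thesis .
    qed
    then have "real n * q ^ (n - 1) \<le> (\<Sum>i<n. q ^ (n - Suc i) * t ^ i)"
      using sum_mono [of "{..<n}" "\<lambda>_. q ^ (n - 1)"] by simp
    then show ?thesis using True by (intro mult_left_mono) auto
  next
    case False
    have "q ^ (n - Suc i) * t ^ i \<le> q ^ (n - 1)" if "i < n" for i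
    proof -
      have "q ^ (n - Suc i) * t ^ i \<le> q ^ (n - Suc i) * q ^ i"
        using False assms by (intro mult_left_mono power_mono) auto
      also have "\<dots> = q ^ (n - 1)"
        using that by (simp add: power_add [symmetric])
      finally show ?thesis .
    qed
    then have "(\<Sum>i<n. q ^ (n - Suc i) * t ^ i) \<le> real n * q ^ (n - 1)"
      using sum_mono [of "{..<n}" _ "\<lambda>_. q ^ (n - 1)"] by simp
    then show ?thesis using False by (intro mult_left_mono_neg) auto
  qed
  then show ?thesis using power_diff_sumr2 [of t n q] by (simp add: ac_simps)
qed

lemma powr_neg_inverse_pred:
  fixes n :: nat
  assumes "2 \<le> n"
  defines "q \<equiv> real n powr (-1 / (real n - 1))"
  shows "0 \<le> q" "q \<le> 1" "real n * q ^ (n - 1) = 1"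
    "q ^ n = real n powr (- real n / (real n - 1))"
proof -
  have pos: "0 < real n - 1" using assms by simp
  show "0 \<le> q" unfolding q_def by simp
  show "q \<le> 1" unfolding q_def
    using pos assms powr_mono [of "-1 / (real n - 1)" 0 "real n"] by (simp add: divide_nonpos_pos)
  have pred: "q ^ (n - 1) = real n powr (-1)"
    unfolding q_def using pos assms by (simp add: powr_realpow [symmetric] powr_powr of_nat_diff)
  then show "real n * q ^ (n - 1) = 1" using assms by (simp add: powr_minus)
  have "q ^ n = q * q ^ (n - 1)" using assms by (cases n) auto
  also have "\<dots> = real n powr (-1 / (real n - 1) + -1)"
    unfolding pred unfolding q_def by (rule powr_add [symmetric])
  also have "-1 / (real n - 1) + -1 = - real n / (real n - 1)"
    using pos by (simp add: field_simps)
  finally show "q ^ n = real n powr (- real n / (real n - 1))" .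
qed

lemma one_minus_power_minus_le:
  fixes u :: real
  assumes "2 \<le> n" "0 \<le> u" "u \<le> 1"
  defines "q \<equiv> real n powr (-1 / (real n - 1))"
  shows "1 - (1 - u) ^ n - u \<le> q - q ^ n"
proof -
  note q = powr_neg_inverse_pred [OF assms(1), folded q_def]
  have "q ^ n + real n * q ^ (n - 1) * ((1 - u) - q) \<le> (1 - u) ^ n"
    using assms q by (intro power_ge_tangent) auto
  then show ?thesis using q(3) by simp
qed

lemma class_CI_prob_space: "class_CI M n X \<Longrightarrow> prob_space M"
  by (simp add: class_CI_def)

context
  fixes M :: "'a measure" and n :: nat and X :: "nat \<Rightarrow> 'a \<Rightarrow> real"
  assumes CI: "class_CI M n X"
begin

interpretation prob_space M
  using CI by (rule class_CI_prob_space)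

lemma class_CI_range: "i < n \<Longrightarrow> \<omega> \<in> space M \<Longrightarrow> X i \<omega> \<in> {0..1}"
  using CI by (simp add: class_CI_def)

lemma class_CI_integrable: "i < n \<Longrightarrow> integrable M (X i)"
  using CI class_CI_range by (intro integrable_const_bound [where B = 1]) (auto simp: class_CI_def)

lemma class_CI_expectation_bounds:
  assumes "i < n"
  shows "0 \<le> expectation (X i)" "expectation (X i) \<le> 1"
proof -
  show "0 \<le> expectation (X i)"
    using assms class_CI_range by (intro integral_nonneg_AE AE_I2) auto
  have "expectation (X i) \<le> expectation (\<lambda>_. 1)"
    using assms class_CI_range class_CI_integrable by (intro integral_mono) auto
  then show "expectation (X i) \<le> 1" by (simp add: prob_space)
qed

lemma class_CI_expectation_le_U: "i < n \<Longrightarrow> expectation (X i) \<le> U_max_exp M n X"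
  unfolding U_max_exp_def by (intro Max_ge) auto

lemma class_CI_U_bounds:
  assumes "1 \<le> n"
  shows "0 \<le> U_max_exp M n X" "U_max_exp M n X \<le> 1"
proof -
  have "U_max_exp M n X \<in> (\<lambda>i. expectation (X i)) ` {..<n}"
    unfolding U_max_exp_def using assms by (intro Max_in) (auto simp: lessThan_empty_iff)
  then show "0 \<le> U_max_exp M n X" "U_max_exp M n X \<le> 1"
    using class_CI_expectation_bounds by auto
qed

lemma class_CI_integrable_Max:
  assumes "1 \<le> n"
  shows "integrable M (\<lambda>\<omega>. MAX i\<in>{..<n}. X i \<omega>)"
proof (rule integrable_const_bound [where B = 1])
  show "AE \<omega> in M. norm (MAX i\<in>{..<n}. X i \<omega>) \<le> 1"
  proof (rule AE_I2)
    fix \<omega> assume "\<omega> \<in> space M"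
    moreover have "(MAX i\<in>{..<n}. X i \<omega>) \<in> (\<lambda>i. X i \<omega>) ` {..<n}"
      using assms by (intro Max_in) (auto simp: lessThan_empty_iff)
    ultimately show "norm (MAX i\<in>{..<n}. X i \<omega>) \<le> 1"
      using class_CI_range by fastforce
  qed
  show "(\<lambda>\<omega>. MAX i\<in>{..<n}. X i \<omega>) \<in> borel_measurable M"
    using CI by (intro borel_measurable_Max) (auto simp: class_CI_def)
qed

lemma class_CI_prod_complement:
  "integrable M (\<lambda>\<omega>. \<Prod>i<n. 1 - X i \<omega>)"
  "expectation (\<lambda>\<omega>. \<Prod>i<n. 1 - X i \<omega>) = (\<Prod>i<n. 1 - expectation (X i))"
proof -
  have "indep_vars (\<lambda>_. borel) X {..<n}"
    using CI by (simp add: class_CI_def)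
  then have indep: "indep_vars (\<lambda>_. borel) (\<lambda>i \<omega>. 1 - X i \<omega>) {..<n}"
    by (rule indep_vars_compose2) auto
  have int: "\<And>i. i \<in> {..<n} \<Longrightarrow> integrable M (\<lambda>\<omega>. 1 - X i \<omega>)"
    using class_CI_integrable by auto
  show "integrable M (\<lambda>\<omega>. \<Prod>i<n. 1 - X i \<omega>)"
    by (rule indep_vars_integrable [OF _ indep int]) simp
  have "expectation (\<lambda>\<omega>. \<Prod>i<n. 1 - X i \<omega>) = (\<Prod>i<n. expectation (\<lambda>\<omega>. 1 - X i \<omega>))"
    by (rule indep_vars_lebesgue_integral [OF _ indep int]) simp
  also have "\<dots> = (\<Prod>i<n. 1 - expectation (X i))"
    using class_CI_integrable by (intro prod.cong) (simp_all add: prob_space)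
  finally show "expectation (\<lambda>\<omega>. \<Prod>i<n. 1 - X i \<omega>) = (\<Prod>i<n. 1 - expectation (X i))" .
qed

lemma class_CI_expectation_one_minus_prod_complement:
  "expectation (\<lambda>\<omega>. 1 - (\<Prod>i<n. 1 - X i \<omega>)) = 1 - (\<Prod>i<n. 1 - expectation (X i))"
  using class_CI_prod_complement by (simp add: prob_space)

lemma class_CI_M_le_n_U:
  assumes "1 \<le> n"
  shows "M_exp_max M n X \<le> real n * U_max_exp M n X"
proof -
  have "M_exp_max M n X \<le> expectation (\<lambda>\<omega>. \<Sum>i<n. X i \<omega>)"
    unfolding M_exp_max_def
  proof (rule integral_mono [OF class_CI_integrable_Max [OF assms]])
    show "integrable M (\<lambda>\<omega>. \<Sum>i<n. X i \<omega>)"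
      using class_CI_integrable by auto
    show "(MAX i\<in>{..<n}. X i \<omega>) \<le> (\<Sum>i<n. X i \<omega>)" if "\<omega> \<in> space M" for \<omega>
      using assms that class_CI_range by (intro Max_le_sum) (auto simp: lessThan_empty_iff)
  qed
  also have "\<dots> = (\<Sum>i<n. expectation (X i))"
    using class_CI_integrable by (intro Bochner_Integration.integral_sum) auto
  also have "\<dots> \<le> real n * U_max_exp M n X"
    using class_CI_expectation_le_U sum_mono [of "{..<n}" _ "\<lambda>_. U_max_exp M n X"] by simp
  finally show ?thesis .
qed

lemma class_CI_M_le_one_minus_prod:
  assumes "1 \<le> n"
  shows "M_exp_max M n X \<le> 1 - (\<Prod>i<n. 1 - expectation (X i))"
proof -
  have "M_exp_max M n X \<le> expectation (\<lambda>\<omega>. 1 - (\<Prod>i<n. 1 - X i \<omega>))"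
    unfolding M_exp_max_def
  proof (rule integral_mono [OF class_CI_integrable_Max [OF assms]])
    show "integrable M (\<lambda>\<omega>. 1 - (\<Prod>i<n. 1 - X i \<omega>))"
      using class_CI_prod_complement(1) by simp
    show "(MAX i\<in>{..<n}. X i \<omega>) \<le> 1 - (\<Prod>i<n. 1 - X i \<omega>)" if "\<omega> \<in> space M" for \<omega>
      using assms that class_CI_range
      by (intro Max_le_one_minus_prod_complement) (auto simp: lessThan_empty_iff)
  qed
  then show ?thesis by (simp only: class_CI_expectation_one_minus_prod_complement)
qed

lemma class_CI_M_eq_one_minus_prod:
  assumes "1 \<le> n" and binary: "\<And>i \<omega>. i < n \<Longrightarrow> \<omega> \<in> space M \<Longrightarrow> X i \<omega> \<in> {0, 1}"
  shows "M_exp_max M n X = 1 - (\<Prod>i<n. 1 - expectation (X i))"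
proof -
  have "M_exp_max M n X = expectation (\<lambda>\<omega>. 1 - (\<Prod>i<n. 1 - X i \<omega>))"
    unfolding M_exp_max_def
  proof (rule Bochner_Integration.integral_cong [OF refl])
    show "(MAX i\<in>{..<n}. X i \<omega>) = 1 - (\<Prod>i<n. 1 - X i \<omega>)" if "\<omega> \<in> space M" for \<omega>
      using assms that by (intro Max_eq_one_minus_prod_complement) (auto simp: lessThan_empty_iff)
  qed
  then show ?thesis by (simp only: class_CI_expectation_one_minus_prod_complement)
qed

end

theorem class_CI_M_minus_U_le:
  assumes "class_CI M n X" "2 \<le> n"
  shows "M_exp_max M n X - U_max_exp M n X
           \<le> real n powr (-1 / (real n - 1)) - real n powr (- real n / (real n - 1))"
proof -
  interpret prob_space M using assms(1) by (rule class_CI_prob_space)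
  define U where "U = U_max_exp M n X"
  have n: "1 \<le> n" using assms(2) by simp
  have U: "0 \<le> U" "U \<le> 1" "\<And>i. i < n \<Longrightarrow> expectation (X i) \<le> U"
    unfolding U_def using class_CI_U_bounds [OF assms(1) n] class_CI_expectation_le_U [OF assms(1)]
    by auto
  have "(1 - U) ^ n \<le> (\<Prod>i<n. 1 - expectation (X i))"
    using U class_CI_expectation_bounds [OF assms(1)] prod_mono [of "{..<n}" "\<lambda>_. 1 - U"] by simp
  then have "M_exp_max M n X - U \<le> 1 - (1 - U) ^ n - U"
    using class_CI_M_le_one_minus_prod [OF assms(1) n] by simp
  also have "\<dots> \<le> real n powr (-1 / (real n - 1)) - (real n powr (-1 / (real n - 1))) ^ n"
    using assms(2) U(1,2) by (rule one_minus_power_minus_le)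
  finally show ?thesis
    unfolding U_def using powr_neg_inverse_pred(4) [OF assms(2)] by simp
qed

theorem class_CI_bernoulli_extremal:
  assumes "class_CI N n Z" "2 \<le> n"
    and binary: "\<forall>i<n. \<forall>\<omega>\<in>space N. Z i \<omega> \<in> {0, 1}"
    and success: "\<forall>i<n. measure N {\<omega>\<in>space N. Z i \<omega> = 1} = 1 - real n powr (-1 / (real n - 1))"
  shows "U_max_exp N n Z = 1 - real n powr (-1 / (real n - 1))
       \<and> M_exp_max N n Z - U_max_exp N n Z
           = real n powr (-1 / (real n - 1)) - real n powr (- real n / (real n - 1))"
proof -
  interpret prob_space N using assms(1) by (rule class_CI_prob_space)
  define q where "q = real n powr (-1 / (real n - 1))"
  have n: "1 \<le> n" using assms(2) by simp
  have E: "expectation (Z i) = 1 - q" if "i < n" for i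
  proof -
    have "expectation (Z i) = expectation (indicator {\<omega>\<in>space N. Z i \<omega> = 1})"
      using binary that by (intro Bochner_Integration.integral_cong) (auto simp: indicator_def)
    also have "\<dots> = measure N {\<omega>\<in>space N. Z i \<omega> = 1}"
      by (simp add: Int_absorb2 subsetI)
    finally show ?thesis using success that q_def by simp
  qed
  have "(\<lambda>i. expectation (Z i)) ` {..<n} = {1 - q}"
    using E n by (auto intro!: image_eqI [of _ _ 0])
  then have U: "U_max_exp N n Z = 1 - q" unfolding U_max_exp_def by simp
  have "M_exp_max N n Z = 1 - q ^ n"
    using class_CI_M_eq_one_minus_prod [OF assms(1) n] binary E by simp
  then show ?thesis
    using U powr_neg_inverse_pred(4) [OF assms(2)] unfolding q_def by simp
qed

theorem mainTheorem3:
  fixes n :: nat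
  assumes "n \<ge> 2"
  shows "(\<forall>(M::'a measure) X. class_CI M n X \<and> U_max_exp M n X > 0 \<longrightarrow>
            M_exp_max M n X / U_max_exp M n X \<le> real n)
       \<and> (\<forall>(M::'a measure) X. class_CI M n X \<longrightarrow>
            M_exp_max M n X - U_max_exp M n X
              \<le> real n powr (-1 / (real n - 1)) - real n powr (- real n / (real n - 1)))
       \<and> (\<forall>(N::'b measure) Z. class_CI N n Z
            \<and> (\<forall>i<n. \<forall>\<omega>\<in>space N. Z i \<omega> \<in> {0, 1})
            \<and> (\<forall>i<n. measure N {\<omega>\<in>space N. Z i \<omega> = 1} = 1 - real n powr (-1 / (real n - 1)))
            \<longrightarrow> U_max_exp N n Z = 1 - real n powr (-1 / (real n - 1))
              \<and> M_exp_max N n Z - U_max_exp N n Z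
                  = real n powr (-1 / (real n - 1)) - real n powr (- real n / (real n - 1)))"
proof (intro conjI allI impI)
  fix M :: "'a measure" and X
  assume "class_CI M n X \<and> U_max_exp M n X > 0"
  then show "M_exp_max M n X / U_max_exp M n X \<le> real n"
    using class_CI_M_le_n_U [of M n X] assms by (simp add: divide_le_eq)
next
  fix M :: "'a measure" and X
  assume "class_CI M n X"
  then show "M_exp_max M n X - U_max_exp M n X
      \<le> real n powr (-1 / (real n - 1)) - real n powr (- real n / (real n - 1))"
    using assms by (rule class_CI_M_minus_U_le)
next
  fix N :: "'b measure" and Z
  assume "class_CI N n Z \<and> (\<forall>i<n. \<forall>\<omega>\<in>space N. Z i \<omega> \<in> {0, 1})
    \<and> (\<forall>i<n. measure N {\<omega>\<in>space N. Z i \<omega> = 1} = 1 - real n powr (-1 / (real n - 1)))"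
  then show "U_max_exp N n Z = 1 - real n powr (-1 / (real n - 1))"
    and "M_exp_max N n Z - U_max_exp N n Z
      = real n powr (-1 / (real n - 1)) - real n powr (- real n / (real n - 1))"
    using class_CI_bernoulli_extremal [OF _ assms, of N Z] by auto
qed

end
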